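(* Let $d\ge 2$ and let $\nu$ be a finite measure on $(0,+\infty)$. Consider the continuous greedy paths model driven by $\nu$ with the quantity $S$ defined in the context. 1. If $\int_0^{+\infty}\nu([r,+\infty))^{1/d}\,dr<+\infty$, then $\mathbb{E}S<+\infty$. 2. If $\int_0^{+\infty} r^d\,\nu(dr)=+\infty$, then $S=+\infty$ almost surely.
   Context: Let $\xi$ be a Poisson point process on $\mathbb{R}^d\times(0,+\infty)$ with intensity the product of Lebesgue measure on $\mathbb{R}^d$ and $\nu$, and let $\Xi$ be its projection on $\mathbb{R}^d$. For $x\in\Xi$, $r(x)$ denotes the (a.s. unique) positive real with $(x,r(x))\in\xi$; for $x\notin\Xi$, $r(x)=0$. A path is a finite sequence $\pi=(x_0,\dots,x_n)$ of distinct points of $\mathbb{R}^d$; its length $|\pi|=\sum_{i=0}^{n-1}\|x_{i+1}-x_i\|$ (Euclidean norm), and its weight $A(\pi)=\sum_{i=0}^n r(x_i)$. Define $S=S(\xi)=\sup\{A(\pi)/|\pi|\}$, the supremum over all paths with $x_0=0$ and $|\pi|>0$. (One works on the almost sure event $0\notin\Xi$.) *)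

theory Defs
  imports "HOL-Probability.Probability"
begin

definition poisson_point_process ::
  "'w measure \<Rightarrow> 'p measure \<Rightarrow> ('w \<Rightarrow> 'p set) \<Rightarrow> bool" where
  "poisson_point_process M \<mu> \<xi> \<longleftrightarrow>
     prob_space M \<and>
     (\<forall>\<omega>\<in>space M. \<xi> \<omega> \<subseteq> space \<mu>) \<and>
     (\<forall>B \<in> sets \<mu>. emeasure \<mu> B < \<infinity> \<longrightarrow>
        (AE \<omega> in M. finite (\<xi> \<omega> \<inter> B)) \<and>
        (\<forall>k::nat. measure M {\<omega>\<in>space M. card (\<xi> \<omega> \<inter> B) = k}
                 = measure \<mu> B ^ k / fact k * exp (- measure \<mu> B))) \<and>
     (\<forall>(I::nat set) B. finite I \<longrightarrow> (\<forall>i\<in>I. B i \<in> sets \<mu> \<and> emeasure \<mu> (B i) < \<infinity>) \<longrightarrow>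
        disjoint_family_on B I \<longrightarrow>
        prob_space.indep_vars M (\<lambda>_. count_space (UNIV :: nat set))
          (\<lambda>i \<omega>. card (\<xi> \<omega> \<inter> B i)) I)"

text \<open>The mark \<open>r(x)\<close> of a point \<open>x\<close> in the projected configuration: the (a.s. unique)
  \<open>r\<close> with \<open>(x,r) \<in> \<xi>\<close>, and \<open>0\<close> if there is none.\<close>
definition mark :: "('a \<times> real) set \<Rightarrow> 'a \<Rightarrow> real" where
  "mark \<xi> x = (if \<exists>!r. (x, r) \<in> \<xi> then (THE r. (x, r) \<in> \<xi>) else 0)"

definition path_length :: "('a::real_normed_vector) list \<Rightarrow> real" where
  "path_length \<pi> = (\<Sum>i<length \<pi> - 1. norm (\<pi> ! (Suc i) - \<pi> ! i))"

definition path_weight :: "('a \<times> real) set \<Rightarrow> 'a list \<Rightarrow> real" where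
  "path_weight \<xi> \<pi> = (\<Sum>i<length \<pi>. mark \<xi> (\<pi> ! i))"

definition greedy_S :: "(('a::real_normed_vector) \<times> real) set \<Rightarrow> ennreal" where
  "greedy_S \<xi> = (SUP \<pi> \<in> {\<pi>. \<pi> \<noteq> [] \<and> distinct \<pi> \<and> hd \<pi> = 0 \<and> path_length \<pi> > 0}.
                   ennreal (path_weight \<xi> \<pi> / path_length \<pi>))"

end

theory Submission
  imports Defs
begin

text \<open>
  Part 1. A mark \<open>r\<close> is at most the number of integers \<open>j \<ge> 0\<close> with \<open>j \<le> r\<close>, so \<open>S\<close> is at most
  the sum over \<open>j\<close> of the unit-weight suprema \<open>S\<^sub>j\<close> built from the points of mark at least \<open>j\<close>, which
  have intensity \<open>\<lambda> = \<nu>[j,\<infinity>)\<close>.  If \<open>S\<^sub>j > s\<close>, some \<open>n \<ge> 1\<close> distinct points are visited by a path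
  from \<open>0\<close> of length less than \<open>n/s\<close>.  The cubes of side \<open>1/s\<close> containing them form one of at most
  \<open>12\<^sup>d\<^sup>n\<close> sequences, and a given sequence can be realised by distinct points with probability at most
  \<open>(\<lambda>/s\<^sup>d)\<^sup>n\<close>, because \<open>P(N \<ge> k) \<le> m\<^sup>k\<close> for a Poisson variable of mean \<open>m\<close> and distinct cubes are
  independent.  Hence \<open>P(S\<^sub>j > s)\<close> is of order \<open>\<lambda>/s\<^sup>d\<close> beyond \<open>s\<^sub>0\<close> of order \<open>\<lambda>\<close> to the power
  \<open>1/d\<close>, which for \<open>d \<ge> 2\<close> gives an expectation of order \<open>s\<^sub>0\<close>.

  Part 2. The set of \<open>(x, r)\<close> with \<open>0 < K x\<^sub>j < r\<close> for every coordinate \<open>j\<close> has infinite intensity, so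
  it almost surely contains a point; the one-step path to that point has ratio at least \<open>K/d\<close>.
\<close>

definition cell :: "real \<Rightarrow> ('d \<Rightarrow> int) \<Rightarrow> (real^'d) set" where
  "cell s z = {x. \<forall>j. \<lfloor>s * x $ j\<rfloor> = z j}"

lemma cell_borel: "cell s z \<in> sets borel"
proof -
  have "cell s z = (\<Inter>j. {x\<in>space borel. \<lfloor>s * x $ j\<rfloor> = z j})"
    by (auto simp: cell_def)
  also have "\<dots> \<in> sets borel"
    by (rule sets.finite_INT) (auto)
  finally show ?thesis .
qed

lemma disjoint_cell: "z \<noteq> z' \<Longrightarrow> cell s z \<inter> cell s z' = {}"
  by (auto simp: cell_def fun_eq_iff)

lemma emeasure_cell_le:
  fixes z :: "'d::finite \<Rightarrow> int"
  assumes "s > 0"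
  shows "emeasure lborel (cell s z) \<le> ennreal ((1 / s) ^ CARD('d))"
proof -
  define a where "a = (\<chi> j. real_of_int (z j) / s)"
  define b where "b = (\<chi> j. real_of_int (z j + 1) / s)"
  have le: "a $ i \<le> b $ i" for i
    using assms by (simp add: a_def b_def divide_right_mono)
  have "cell s z \<subseteq> cbox a b"
  proof
    fix x assume "x \<in> cell s z"
    then have "of_int (z j) \<le> s * x $ j \<and> s * x $ j < of_int (z j) + 1" for j
      by (simp add: cell_def floor_eq_iff)
    then show "x \<in> cbox a b"
      using assms unfolding mem_box_cart a_def b_def
      by (auto simp: field_simps less_imp_le)
  qed
  then have "emeasure lborel (cell s z) \<le> emeasure lborel (cbox a b)"
    by (intro emeasure_mono) auto
  also have "\<dots> = ennreal (measure lborel (cbox a b))"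
    by (metis emeasure_eq_ennreal_measure emeasure_lborel_cbox_finite less_irrefl infinity_ennreal_def)
  also have "measure lborel (cbox a b) = (\<Prod>i\<in>UNIV. b $ i - a $ i)"
    using le by (intro content_cbox_cart) (auto simp: interval_ne_empty_cart)
  also have "\<dots> = (1 / s) ^ CARD('d)"
    using assms by (simp add: a_def b_def diff_divide_distrib[symmetric])
  finally show ?thesis .
qed

lemma sum_half_power_abs_le: "(\<Sum>k=-int R..int R. (1/2::real) ^ nat \<bar>k\<bar>) \<le> 3"
proof -
  have "(\<Sum>k=-int R..int R. (1/2::real) ^ nat \<bar>k\<bar>) = 3 - 2 * (1/2)^R"
  proof (induction R)
    case (Suc R)
    have "{-int (Suc R)..int (Suc R)} = insert (-int (Suc R)) (insert (int (Suc R)) {-int R..int R})"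
      by auto
    then show ?case using Suc by (simp add: nat_add_distrib)
  qed simp
  then show ?thesis by simp
qed

definition short_steps :: "'i set \<Rightarrow> ('i \<Rightarrow> int) set" where
  "short_steps I = {g \<in> I \<rightarrow>\<^sub>E UNIV. (\<Sum>i\<in>I. \<bar>g i\<bar>) \<le> 2 * int (card I)}"

text \<open>Weighting each step function by \<open>2\<close> to the power \<open>2 |I| - \<Sum>|g i|\<close> (which is at least \<open>1\<close>)
  turns the count into a product of one-dimensional geometric sums.\<close>
lemma card_short_steps:
  assumes "finite I"
  shows "finite (short_steps I)" "card (short_steps I) \<le> 12 ^ card I"
proof -
  define R where "R = 2 * card I"
  let ?P = "I \<rightarrow>\<^sub>E {-int R..int R}"
  have sub: "short_steps I \<subseteq> ?P"
  proof
    fix g assume g: "g \<in> short_steps I"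
    have "\<bar>g i\<bar> \<le> int R" if "i \<in> I" for i
    proof -
      have "\<bar>g i\<bar> \<le> (\<Sum>i\<in>I. \<bar>g i\<bar>)"
        using that assms by (intro member_le_sum) auto
      then show ?thesis using g by (simp add: short_steps_def R_def)
    qed
    then have "g i \<in> {-int R..int R}" if "i \<in> I" for i
      using that by (simp add: abs_le_iff minus_le_iff)
    moreover have "g \<in> extensional I"
      using g by (simp add: short_steps_def PiE_iff)
    ultimately show "g \<in> ?P" by (simp only: PiE_iff simp_thms ball_simps) blast
  qed
  have finP: "finite ?P" using assms by (intro finite_PiE) auto
  then show fin: "finite (short_steps I)" using sub finite_subset by blast
  have one: "1 \<le> 4 ^ card I * (\<Prod>i\<in>I. (1/2::real) ^ nat \<bar>g i\<bar>)" if g: "g \<in> short_steps I" for g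
  proof -
    have "(\<Sum>i\<in>I. nat \<bar>g i\<bar>) \<le> 2 * card I"
      using g by (simp add: short_steps_def flip: of_nat_le_iff[where 'a=int])
    then have "(1/2::real) ^ (2 * card I) \<le> (1/2) ^ (\<Sum>i\<in>I. nat \<bar>g i\<bar>)"
      by (intro power_decreasing) auto
    then have "1 \<le> 2 ^ (2 * card I) * (1/2::real) ^ (\<Sum>i\<in>I. nat \<bar>g i\<bar>)"
      by (simp add: field_simps)
    then show ?thesis by (simp add: power_mult power_sum)
  qed
  have "real (card (short_steps I)) = (\<Sum>g\<in>short_steps I. 1)" by simp
  also have "\<dots> \<le> (\<Sum>g\<in>short_steps I. 4 ^ card I * (\<Prod>i\<in>I. (1/2::real) ^ nat \<bar>g i\<bar>))"
    using one by (intro sum_mono) auto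
  also have "\<dots> \<le> (\<Sum>g\<in>?P. 4 ^ card I * (\<Prod>i\<in>I. (1/2::real) ^ nat \<bar>g i\<bar>))"
    using finP sub by (intro sum_mono2) (auto intro!: mult_nonneg_nonneg prod_nonneg)
  also have "\<dots> = 4 ^ card I * (\<Prod>i\<in>I. \<Sum>k=-int R..int R. (1/2::real) ^ nat \<bar>k\<bar>)"
    using assms by (subst prod_sum_PiE) (auto simp: sum_distrib_left)
  also have "\<dots> \<le> 4 ^ card I * (\<Prod>i\<in>I. 3)"
    by (intro mult_left_mono prod_mono) (auto intro: sum_nonneg sum_half_power_abs_le)
  also have "\<dots> = 12 ^ card I"
    by (simp flip: power_mult_distrib)
  finally show "card (short_steps I) \<le> 12 ^ card I"
    by (metis of_nat_le_iff of_nat_numeral of_nat_power)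
qed

lemma path_length_singleton [simp]: "path_length [a] = 0"
  by (simp add: path_length_def)

lemma path_length_Cons_Cons [simp]:
  "path_length (a # b # xs) = norm (b - a) + path_length (b # xs)"
  by (simp add: path_length_def sum.lessThan_Suc_shift del: sum.lessThan_Suc)

lemma path_length_change_start:
  "path_length (a # xs) \<le> norm (b - a) + path_length (b # xs)"
proof (cases xs)
  case (Cons c ys)
  have "norm (c - a) \<le> norm (b - a) + norm (c - b)"
    using norm_triangle_ineq[of "b - a" "c - b"] by simp
  then show ?thesis by (simp add: Cons)
qed simp

lemma path_length_filter_le: "path_length (a # filter P xs) \<le> path_length (a # xs)"
proof (induction xs arbitrary: a)
  case (Cons b xs)
  show ?case
    using path_length_change_start[of a "filter P xs" b] Cons[of b] by auto
qed simp

lemma path_length_filter_from_hd: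
  assumes "xs \<noteq> []" "hd xs = a"
  shows "path_length (a # filter P xs) \<le> path_length xs"
  using path_length_filter_le[of a P xs] assms by (cases xs) (auto split: if_splits)

lemma abs_floor_diff_le:
  fixes a b :: real
  shows "real_of_int \<bar>\<lfloor>a\<rfloor> - \<lfloor>b\<rfloor>\<bar> \<le> \<bar>a - b\<bar> + 1"
  by linarith

lemma exp_tail_le:
  fixes m :: real
  assumes "m \<ge> 0"
  shows "1 - (\<Sum>j<k. m ^ j / fact j * exp (-m)) \<le> m ^ k"
proof -
  obtain t where t: "\<bar>t\<bar> \<le> \<bar>m\<bar>" "exp m = (\<Sum>j<k. m ^ j / fact j) + exp t / fact k * m ^ k"
    using Maclaurin_exp_le by blast
  have "1 - (\<Sum>j<k. m ^ j / fact j * exp (-m)) = exp (-m) * (exp m - (\<Sum>j<k. m ^ j / fact j))"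
    by (simp add: algebra_simps sum_distrib_left flip: exp_add)
  also have "\<dots> = exp (t - m) / fact k * m ^ k"
    unfolding t(2) by (simp add: exp_diff exp_minus field_simps)
  also have "\<dots> \<le> 1 * m ^ k"
  proof (rule mult_right_mono)
    have "exp (t - m) \<le> 1" using t(1) assms by simp
    moreover have "(fact k :: real) \<ge> 1" by simp
    ultimately show "exp (t - m) / fact k \<le> 1"
      by (metis divide_le_eq_1_pos fact_gt_zero order_trans)
  qed (use assms in auto)
  finally show ?thesis by simp
qed

lemma mark_mem: "mark X x \<noteq> 0 \<Longrightarrow> (x, mark X x) \<in> X"
  unfolding mark_def by (auto split: if_splits intro: theI')

definition level_S :: "('a::real_normed_vector \<times> real) set \<Rightarrow> real \<Rightarrow> ennreal" where
  "level_S X t = (SUP \<pi> \<in> {\<pi>. \<pi> \<noteq> [] \<and> distinct \<pi> \<and> hd \<pi> = 0 \<and> path_length \<pi> > 0}.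
     ennreal (real (length (filter (\<lambda>x. \<exists>r\<ge>t. (x, r) \<in> X) \<pi>)) / path_length \<pi>))"

lemma mark_le_sum_levels:
  assumes "mark X x \<le> real J"
  shows "mark X x \<le> (\<Sum>j<J. of_bool (\<exists>r\<ge>real j. (x, r) \<in> X))"
proof (cases "mark X x \<le> 0")
  case True
  also have "0 \<le> (\<Sum>j<J. of_bool (\<exists>r\<ge>real j. (x, r) \<in> X) :: real)"
    by (intro sum_nonneg) simp
  finally show ?thesis .
next
  case False
  define k where "k = nat \<lceil>mark X x\<rceil>"
  have mem: "(x, mark X x) \<in> X" using False by (intro mark_mem) auto
  have kJ: "k \<le> J" using assms by (simp add: k_def ceiling_le_iff nat_le_iff)
  have "real j \<le> mark X x" if "j < k" for j
    using that False unfolding k_def by linarith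
  then have "(\<Sum>j<k. of_bool (\<exists>r\<ge>real j. (x, r) \<in> X)) = (\<Sum>j<k. 1 :: real)"
    using mem by (intro sum.cong) auto
  moreover have "mark X x \<le> real k" unfolding k_def by linarith
  moreover have "(\<Sum>j<k. of_bool (\<exists>r\<ge>real j. (x, r) \<in> X) :: real)
      \<le> (\<Sum>j<J. of_bool (\<exists>r\<ge>real j. (x, r) \<in> X))"
    using kJ by (intro sum_mono2) auto
  ultimately show ?thesis by simp
qed

lemma greedy_S_le_suminf_level_S: "greedy_S X \<le> (\<Sum>j. level_S X (real j))"
  unfolding greedy_S_def
proof (rule SUP_least, clarsimp)
  fix \<pi> :: "'a list"
  assume \<pi>: "\<pi> \<noteq> []" "distinct \<pi>" "hd \<pi> = 0" "path_length \<pi> > 0"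
  let ?n = "\<lambda>j. real (length (filter (\<lambda>x. \<exists>r\<ge>real j. (x, r) \<in> X) \<pi>))"
  obtain J where J: "(\<Sum>x\<in>set \<pi>. \<bar>mark X x\<bar>) \<le> real J"
    using real_arch_simple by blast
  have "path_weight X \<pi> = (\<Sum>x\<in>set \<pi>. mark X x)"
    using \<pi>(2) sum_list_distinct_conv_sum_set[of \<pi> "mark X"]
    by (simp add: path_weight_def sum_list_sum_nth atLeast0LessThan)
  also have "\<dots> \<le> (\<Sum>x\<in>set \<pi>. \<Sum>j<J. of_bool (\<exists>r\<ge>real j. (x, r) \<in> X))"
  proof (intro sum_mono mark_le_sum_levels)
    fix x assume "x \<in> set \<pi>"
    then have "\<bar>mark X x\<bar> \<le> (\<Sum>x\<in>set \<pi>. \<bar>mark X x\<bar>)" by (intro member_le_sum) auto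
    then show "mark X x \<le> real J" using J by linarith
  qed
  also have "\<dots> = (\<Sum>j<J. \<Sum>x\<in>set \<pi>. of_bool (\<exists>r\<ge>real j. (x, r) \<in> X))"
    by (rule sum.swap)
  also have "\<dots> = (\<Sum>j<J. ?n j)"
    using \<pi>(2) by (simp add: distinct_length_filter sum_of_bool_eq Int_commute)
  finally have "path_weight X \<pi> / path_length \<pi> \<le> (\<Sum>j<J. ?n j / path_length \<pi>)"
    using \<pi>(4) by (simp add: divide_right_mono flip: sum_divide_distrib)
  then have "ennreal (path_weight X \<pi> / path_length \<pi>) \<le> ennreal (\<Sum>j<J. ?n j / path_length \<pi>)"
    by (rule ennreal_leI)
  also have "\<dots> = (\<Sum>j<J. ennreal (?n j / path_length \<pi>))"
    using \<pi>(4) by (intro sum_ennreal[symmetric]) auto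
  also have "\<dots> \<le> (\<Sum>j<J. level_S X (real j))"
    unfolding level_S_def using \<pi> by (intro sum_mono SUP_upper) auto
  also have "\<dots> \<le> (\<Sum>j. level_S X (real j))"
    by (intro sum_le_suminf) auto
  finally show "ennreal (path_weight X \<pi> / path_length \<pi>) \<le> (\<Sum>j. level_S X (real j))" .
qed

lemma suminf_nat_le_nn_integral:
  fixes f :: "real \<Rightarrow> ennreal"
  assumes "antimono f"
  shows "(\<Sum>j. f (real (Suc j))) \<le> (\<integral>\<^sup>+ r\<in>{0<..}. f r \<partial>lborel)"
proof -
  have "(\<Sum>j. f (real (Suc j))) = (\<Sum>j. \<integral>\<^sup>+ r. f (real (Suc j)) * indicator {real j<..real (Suc j)} r \<partial>lborel)"
    by (intro suminf_cong) (simp add: nn_integral_cmult_indicator)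
  also have "\<dots> = (\<integral>\<^sup>+ r. (\<Sum>j. f (real (Suc j)) * indicator {real j<..real (Suc j)} r) \<partial>lborel)"
    by (intro nn_integral_suminf[symmetric]) auto
  also have "\<dots> \<le> (\<integral>\<^sup>+ r\<in>{0<..}. f r \<partial>lborel)"
  proof (rule nn_integral_mono)
    fix r :: real
    define k where "k = nat \<lceil>r\<rceil> - 1"
    have k: "r \<in> {real j<..real (Suc j)} \<longleftrightarrow> j = k \<and> r > 0" for j
      unfolding k_def greaterThanAtMost_iff by linarith
    have "(\<Sum>j. f (real (Suc j)) * indicator {real j<..real (Suc j)} r) =
        (\<Sum>j\<in>{k}. f (real (Suc j)) * indicator {real j<..real (Suc j)} r)"
      using k by (intro suminf_finite) (auto simp del: greaterThanAtMost_iff of_nat_Suc simp: indicator_def)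
    also have "\<dots> = f (real (Suc k)) * indicator {real k<..real (Suc k)} r"
      by (simp only: sum.insert sum.empty finite.emptyI empty_iff not_False_eq_True add_0_right)
    also have "\<dots> \<le> f r * indicator {0<..} r"
    proof (cases "r > 0")
      case True
      then have "r \<le> real (Suc k)" using k[of k] by auto
      then have "f (real (Suc k)) \<le> f r" using assms by (simp add: antimono_def)
      then show ?thesis using True by (simp add: indicator_def del: of_nat_Suc)
    next
      case False
      then have "r \<notin> {real k<..real (Suc k)}" using k by blast
      then show ?thesis by (auto simp: indicator_def)
    qed
    finally show "(\<Sum>j. f (real (Suc j)) * indicator {real j<..real (Suc j)} r) \<le> f r * indicator {0<..} r" .
  qed
  finally show ?thesis .
qed

lemma greedy_S_ge_of_point:
  fixes x :: "real^'d"
  assumes pos: "\<forall>(x, r)\<in>X. r > 0"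
    and uniq: "\<forall>x r r'. (x, r) \<in> X \<longrightarrow> (x, r') \<in> X \<longrightarrow> r \<ge> 0 \<longrightarrow> r' \<ge> 0 \<longrightarrow> r = r'"
    and x: "(x, r) \<in> X" "\<forall>j. 0 < x $ j \<and> K * x $ j < r" and K: "K > 0"
  shows "greedy_S X \<ge> ennreal (K / CARD('d))"
proof -
  have mark: "mark X x = r"
  proof -
    have "r' = r" if "(x, r') \<in> X" for r'
      using uniq[rule_format, OF that x(1)] bspec[OF pos that] bspec[OF pos x(1)] by simp
    then have "\<exists>!r. (x, r) \<in> X" using x(1) by blast
    then show ?thesis using x(1) unfolding mark_def by (simp add: the1_equality)
  qed
  have mark0: "mark X 0 \<ge> 0"
    using mark_mem[of X 0] pos by (cases "mark X 0 = 0") auto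
  have x0: "x \<noteq> 0" using x(2) by (metis less_irrefl zero_index)
  have "norm x \<le> (\<Sum>j\<in>UNIV. \<bar>x $ j\<bar>)" by (rule norm_le_l1_cart)
  also have "\<dots> \<le> (\<Sum>j\<in>(UNIV :: 'd set). r / K)"
    using x(2) K by (intro sum_mono) (simp add: field_simps less_imp_le)
  finally have "K * norm x \<le> CARD('d) * r" using K by (simp add: field_simps)
  then have "K / CARD('d) \<le> r / norm x" using x0 by (simp add: field_simps)
  also have "\<dots> \<le> path_weight X [0, x] / path_length [0, x]"
    using mark0 mark by (simp add: path_weight_def divide_right_mono)
  finally have "ennreal (K / CARD('d)) \<le> ennreal (path_weight X [0, x] / path_length [0, x])"
    by (rule ennreal_leI)
  also have "\<dots> \<le> greedy_S X"
    unfolding greedy_S_def using x0 by (intro SUP_upper) auto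
  finally show ?thesis .
qed

locale marked_poisson_process =
  fixes M :: "'w measure"
    and \<nu> :: "real measure"
    and \<xi> :: "'w \<Rightarrow> ((real^'d) \<times> real) set"
  assumes nu_sets [measurable_cong]: "sets \<nu> = sets borel"
    and nu_finite: "finite_measure \<nu>"
    and ppp: "poisson_point_process M (lborel \<Otimes>\<^sub>M \<nu>) \<xi>"
begin

sublocale prob_space M
  using ppp by (simp add: poisson_point_process_def)

sublocale nu: finite_measure \<nu>
  by (rule nu_finite)

abbreviation \<mu> :: "((real^'d) \<times> real) measure" where
  "\<mu> \<equiv> lborel \<Otimes>\<^sub>M \<nu>"

abbreviation N :: "((real^'d) \<times> real) set \<Rightarrow> 'w \<Rightarrow> nat" where
  "N B \<omega> \<equiv> card (\<xi> \<omega> \<inter> B)"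

lemma AE_finite_points:
  assumes "B \<in> sets \<mu>" "emeasure \<mu> B < \<infinity>"
  shows "AE \<omega> in M. finite (\<xi> \<omega> \<inter> B)"
  using ppp assms by (simp add: poisson_point_process_def)

lemma prob_N_eq:
  assumes "B \<in> sets \<mu>" "emeasure \<mu> B < \<infinity>"
  shows "prob {\<omega>\<in>space M. N B \<omega> = k} = measure \<mu> B ^ k / fact k * exp (- measure \<mu> B)"
  using ppp assms by (simp add: poisson_point_process_def)

lemma indep_N:
  fixes I :: "nat set"
  assumes "finite I" "\<And>i. i \<in> I \<Longrightarrow> B i \<in> sets \<mu>" "\<And>i. i \<in> I \<Longrightarrow> emeasure \<mu> (B i) < \<infinity>"
    "disjoint_family_on B I"
  shows "indep_vars (\<lambda>_. count_space UNIV) (\<lambda>i. N (B i)) I"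
proof -
  have "\<forall>(I::nat set) B. finite I \<longrightarrow> (\<forall>i\<in>I. B i \<in> sets \<mu> \<and> emeasure \<mu> (B i) < \<infinity>) \<longrightarrow>
        disjoint_family_on B I \<longrightarrow>
        indep_vars (\<lambda>_. count_space UNIV) (\<lambda>i \<omega>. N (B i) \<omega>) I"
    using ppp unfolding poisson_point_process_def by (elim conjE)
  from this[rule_format, of I B] show ?thesis using assms by simp
qed

lemma measurable_N:
  assumes "B \<in> sets \<mu>" "emeasure \<mu> B < \<infinity>"
  shows "N B \<in> M \<rightarrow>\<^sub>M count_space UNIV"
proof -
  have "indep_vars (\<lambda>_. count_space UNIV) (\<lambda>i. N B) {0::nat}"
    using assms by (intro indep_N) (auto simp: disjoint_family_on_def)
  then show ?thesis by (auto simp: indep_vars_def)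
qed

lemma prob_N_ge_le:
  assumes B: "B \<in> sets \<mu>" "emeasure \<mu> B < \<infinity>"
  shows "prob {\<omega>\<in>space M. k \<le> N B \<omega>} \<le> measure \<mu> B ^ k"
proof -
  note [measurable] = measurable_N[OF B]
  have "prob {\<omega>\<in>space M. k \<le> N B \<omega>} = 1 - prob {\<omega>\<in>space M. \<not> k \<le> N B \<omega>}"
    using prob_neg[of "\<lambda>\<omega>. \<not> k \<le> N B \<omega>"] by simp
  also have "{\<omega>\<in>space M. \<not> k \<le> N B \<omega>} = (\<Union>j\<in>{..<k}. {\<omega>\<in>space M. N B \<omega> = j})"
    by auto
  also have "prob \<dots> = (\<Sum>j<k. prob {\<omega>\<in>space M. N B \<omega> = j})"
    by (intro finite_measure_finite_Union) (auto simp: disjoint_family_on_def)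
  also have "\<dots> = (\<Sum>j<k. measure \<mu> B ^ j / fact j * exp (- measure \<mu> B))"
    by (simp only: prob_N_eq[OF B])
  also have "1 - \<dots> \<le> measure \<mu> B ^ k"
    by (intro exp_tail_le) simp
  finally show ?thesis .
qed

lemma AE_no_points:
  assumes "B \<in> sets \<mu>" "emeasure \<mu> B = 0"
  shows "AE \<omega> in M. \<xi> \<omega> \<inter> B = {}"
proof -
  have B: "B \<in> sets \<mu>" "emeasure \<mu> B < \<infinity>" using assms by auto
  note [measurable] = measurable_N[OF B]
  have "prob {\<omega>\<in>space M. 1 \<le> N B \<omega>} \<le> 0"
    using prob_N_ge_le[OF B, of 1] assms by (simp add: measure_def)
  then have "AE \<omega> in M. \<not> 1 \<le> N B \<omega>"
    by (subst AE_iff_measurable[OF _ refl]) 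
       (auto simp: emeasure_eq_measure measure_le_0_iff)
  with AE_finite_points[OF B] show ?thesis
    by eventually_elim (metis One_nat_def Suc_leI card_gt_0_iff)
qed

definition bin :: "real \<Rightarrow> real \<Rightarrow> ('d \<Rightarrow> int) \<Rightarrow> ((real^'d) \<times> real) set" where
  "bin s t z = cell s z \<times> {t..}"

lemma bin_sets: "bin s t z \<in> sets \<mu>"
  unfolding bin_def using cell_borel by (intro pair_measureI) (auto simp: nu_sets)

lemma emeasure_bin_le:
  assumes "s > 0"
  shows "emeasure \<mu> (bin s t z) \<le> ennreal (measure \<nu> {t..} * (1/s) ^ CARD('d))"
proof -
  have "emeasure \<mu> (bin s t z) = emeasure lborel (cell s z) * emeasure \<nu> {t..}"
    unfolding bin_def using cell_borel
    by (intro nu.emeasure_pair_measure_Times) (auto simp: nu_sets)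
  also have "\<dots> \<le> ennreal ((1/s) ^ CARD('d)) * ennreal (measure \<nu> {t..})"
    by (intro mult_mono emeasure_cell_le assms) (auto simp: nu.emeasure_eq_measure)
  finally show ?thesis using assms by (simp add: ennreal_mult mult.commute)
qed

lemma emeasure_bin_finite: "s > 0 \<Longrightarrow> emeasure \<mu> (bin s t z) < \<infinity>"
  using emeasure_bin_le[of s t z] by (auto simp: top_unique less_top[symmetric])

lemma measure_bin_le:
  assumes "s > 0"
  shows "measure \<mu> (bin s t z) \<le> measure \<nu> {t..} * (1/s) ^ CARD('d)"
  using emeasure_bin_le[OF assms, of t z] assms
  by (simp add: measure_def enn2real_leI)

text \<open>If distinct points occupy the cells \<open>z 0, \<dots>, z (n - 1)\<close> in this order, each cell contains at
  least as many points as the number of times it is listed.\<close>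
definition occupied :: "real \<Rightarrow> real \<Rightarrow> nat \<Rightarrow> (nat \<Rightarrow> 'd \<Rightarrow> int) \<Rightarrow> 'w set" where
  "occupied s t n z =
     {\<omega>\<in>space M. \<forall>c\<in>z ` {..<n}. card {i. i < n \<and> z i = c} \<le> N (bin s t c) \<omega>}"

lemma occupied_events:
  assumes "s > 0"
  shows "occupied s t n z \<in> events"
proof -
  have [measurable]: "N (bin s t c) \<in> M \<rightarrow>\<^sub>M count_space UNIV" for c
    using assms by (intro measurable_N bin_sets emeasure_bin_finite)
  show ?thesis unfolding occupied_def by measurable
qed

lemma prob_occupied_le:
  assumes s: "s > 0"
  shows "prob (occupied s t n z) \<le> (measure \<nu> {t..} * (1/s) ^ CARD('d)) ^ n"
proof (cases "n = 0")
  case False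
  define m where "m = measure \<nu> {t..} * (1/s) ^ CARD('d)"
  define C where "C = z ` {..<n}"
  define J where "J = to_nat ` C"
  define B where "B i = bin s t (from_nat i)" for i
  define k where "k c = card {i. i < n \<and> z i = c}" for c
  have C: "finite C" "C \<noteq> {}" using False by (auto simp: C_def)
  have ind: "indep_vars (\<lambda>_. count_space UNIV) (\<lambda>i. N (B i)) J"
  proof (rule indep_N)
    show "disjoint_family_on B J"
      using disjoint_cell by (fastforce simp: disjoint_family_on_def B_def J_def bin_def)
    show "finite J" using C by (simp add: J_def)
    show "B i \<in> sets \<mu>" for i
      unfolding B_def by (rule bin_sets)
    show "emeasure \<mu> (B i) < \<infinity>" for i
      unfolding B_def using s by (rule emeasure_bin_finite)
  qed
  have "occupied s t n z = (\<Inter>i\<in>J. N (B i) -` {k (from_nat i)..} \<inter> space M)"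
    using C by (auto simp: occupied_def J_def B_def k_def C_def[symmetric])
  then have "prob (occupied s t n z) = prob (\<Inter>i\<in>J. N (B i) -` {k (from_nat i)..} \<inter> space M)"
    by simp
  also have "\<dots> = (\<Prod>i\<in>J. prob (N (B i) -` {k (from_nat i)..} \<inter> space M))"
    using C by (intro indep_varsD[OF ind]) (auto simp: J_def)
  also have "\<dots> = (\<Prod>c\<in>C. prob (N (bin s t c) -` {k c..} \<inter> space M))"
    unfolding J_def B_def by (subst prod.reindex) (auto simp: inj_on_def)
  also have "\<dots> \<le> (\<Prod>c\<in>C. m ^ k c)"
  proof (intro prod_mono conjI)
    fix c
    have "prob (N (bin s t c) -` {k c..} \<inter> space M) = prob {\<omega>\<in>space M. k c \<le> N (bin s t c) \<omega>}"
      by (rule arg_cong[where f = prob]) auto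
    also have "\<dots> \<le> measure \<mu> (bin s t c) ^ k c"
      using s by (intro prob_N_ge_le bin_sets emeasure_bin_finite)
    also have "\<dots> \<le> m ^ k c"
      using s measure_bin_le by (intro power_mono) (auto simp: m_def)
    finally show "prob (N (bin s t c) -` {k c..} \<inter> space M) \<le> m ^ k c" .
  qed simp
  also have "\<dots> = m ^ (\<Sum>c\<in>C. k c)" by (simp add: power_sum)
  also have "(\<Sum>c\<in>C. k c) = n"
  proof -
    have "(\<Sum>c\<in>C. k c) = (\<Sum>c\<in>C. \<Sum>i\<in>{i\<in>{..<n}. z i = c}. 1)" by (simp add: k_def)
    also have "\<dots> = (\<Sum>i<n. 1)"
      using C by (intro sum.group) (auto simp: C_def)
    finally show ?thesis by simp
  qed
  finally show ?thesis by (simp add: m_def)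
qed simp

definition site :: "(nat \<times> 'd \<Rightarrow> int) \<Rightarrow> nat \<Rightarrow> 'd \<Rightarrow> int" where
  "site g i j = (\<Sum>l\<le>i. g (l, j))"

definition crowded :: "real \<Rightarrow> real \<Rightarrow> 'w set" where
  "crowded s t = (\<Union>n. \<Union>g\<in>short_steps ({..<Suc n} \<times> UNIV). occupied s t (Suc n) (site g))"

lemma crowded_events: "s > 0 \<Longrightarrow> crowded s t \<in> events"
  unfolding crowded_def
  by (intro sets.countable_UN sets.finite_UN image_subsetI card_short_steps occupied_events) auto

lemma emeasure_crowded_le:
  assumes s: "s > 0" and q: "12 ^ CARD('d) * (measure \<nu> {t..} * (1/s) ^ CARD('d)) \<le> q" "q \<le> 1/2"
  shows "emeasure M (crowded s t) \<le> ennreal (2 * q)"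
proof -
  define m where "m = measure \<nu> {t..} * (1/s) ^ CARD('d)"
  define G where "G n = short_steps ({..<Suc n} \<times> (UNIV :: 'd set))" for n
  have m0: "m \<ge> 0" using s by (simp add: m_def)
  have q0: "q \<ge> 0" using q m0 by (smt (verit) m_def zero_le_mult_iff zero_le_power)
  have G: "finite (G n)" "real (card (G n)) \<le> (12 ^ CARD('d)) ^ Suc n" for n
  proof -
    show "finite (G n)" unfolding G_def by (intro card_short_steps) auto
    have "card (G n) \<le> 12 ^ (Suc n * CARD('d))"
      using card_short_steps(2)[of "{..<Suc n} \<times> (UNIV :: 'd set)"]
      by (simp add: G_def card_cartesian_product)
    also have "\<dots> = (12 ^ CARD('d)) ^ Suc n"
      by (simp only: mult.commute[of "Suc n"] power_mult)
    finally show "real (card (G n)) \<le> (12 ^ CARD('d)) ^ Suc n"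
      by (metis of_nat_le_iff of_nat_numeral of_nat_power)
  qed
  have ev: "occupied s t n z \<in> events" for n z by (rule occupied_events[OF s])
  have "emeasure M (crowded s t) \<le> (\<Sum>n. emeasure M (\<Union>g\<in>G n. occupied s t (Suc n) (site g)))"
    unfolding crowded_def G_def[symmetric] using ev G
    by (intro emeasure_subadditive_countably) auto
  also have "\<dots> \<le> (\<Sum>n. ennreal (q ^ Suc n))"
  proof (intro suminf_le summableI)
    fix n
    have "prob (\<Union>g\<in>G n. occupied s t (Suc n) (site g))
        \<le> (\<Sum>g\<in>G n. prob (occupied s t (Suc n) (site g)))"
      using ev G by (intro finite_measure_subadditive_finite) auto
    also have "\<dots> \<le> (\<Sum>g\<in>G n. m ^ Suc n)"
      using prob_occupied_le[OF s] by (intro sum_mono) (simp only: m_def)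
    also have "\<dots> = real (card (G n)) * m ^ Suc n" by simp
    also have "\<dots> \<le> (12 ^ CARD('d)) ^ Suc n * m ^ Suc n"
      using m0 G by (intro mult_right_mono) auto
    also have "\<dots> = (12 ^ CARD('d) * m) ^ Suc n" by (simp only: power_mult_distrib)
    also have "\<dots> \<le> q ^ Suc n"
      using q m0 by (intro power_mono) (auto simp: m_def)
    finally show "emeasure M (\<Union>g\<in>G n. occupied s t (Suc n) (site g)) \<le> ennreal (q ^ Suc n)"
      by (simp only: emeasure_eq_measure ennreal_leI)
  qed
  also have "\<dots> = ennreal (\<Sum>n. q ^ Suc n)"
    using q q0 by (intro suminf_ennreal2) (auto intro!: summable_mult summable_geometric)
  also have "(\<Sum>n. q ^ Suc n) = q * (1 / (1 - q))"
    using q q0 by (simp add: suminf_mult suminf_geometric summable_geometric)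
  also have "\<dots> \<le> q * 2"
    using q q0 by (intro mult_left_mono) (auto simp: field_simps)
  finally show ?thesis by (simp add: mult.commute ennreal_leI)
qed

lemma crowdedI:
  assumes s: "s > 0" and \<omega>: "\<omega> \<in> space M"
    and fin: "\<And>z. finite (\<xi> \<omega> \<inter> bin s t z)"
    and ys: "distinct ys" "ys \<noteq> []" "\<And>y. y \<in> set ys \<Longrightarrow> \<exists>r\<ge>t. (y, r) \<in> \<xi> \<omega>"
    and short: "s * path_length (0 # ys) \<le> length ys"
  shows "\<omega> \<in> crowded s t"
proof -
  define n where "n = length ys"
  define I where "I = {..<n} \<times> (UNIV :: 'd set)"
  define f where "f x j = \<lfloor>s * x $ j\<rfloor>" for x :: "real^'d" and j
  define g where "g = restrict (\<lambda>(i, j). f (ys ! i) j - f ((0 # ys) ! i) j) I"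
  have site: "site g i = f (ys ! i)" if "i < n" for i
  proof
    fix j
    show "site g i j = f (ys ! i) j"
      using that
    proof (induction i)
      case 0
      then show ?case by (simp add: site_def g_def I_def f_def)
    next
      case (Suc i)
      then show ?case by (simp add: site_def g_def I_def)
    qed
  qed
  have "real_of_int (\<Sum>p\<in>I. \<bar>g p\<bar>) = (\<Sum>p\<in>I. real_of_int \<bar>g p\<bar>)"
    by simp
  also have "\<dots> \<le> (\<Sum>(i, j)\<in>I. s * norm (ys ! i - (0 # ys) ! i) + 1)"
  proof (intro sum_mono)
    fix p assume p: "p \<in> I"
    obtain i j where ij: "p = (i, j)" by fastforce
    have "real_of_int \<bar>g p\<bar> \<le> \<bar>s * ys ! i $ j - s * (0 # ys) ! i $ j\<bar> + 1"
      using p ij abs_floor_diff_le[of "s * ys ! i $ j" "s * (0 # ys) ! i $ j"]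
      by (simp add: g_def f_def)
    also have "\<bar>s * ys ! i $ j - s * (0 # ys) ! i $ j\<bar> = s * \<bar>(ys ! i - (0 # ys) ! i) $ j\<bar>"
      using s by (simp add: abs_mult flip: right_diff_distrib)
    also have "\<dots> \<le> s * norm (ys ! i - (0 # ys) ! i)"
      using s by (intro mult_left_mono component_le_norm_cart) auto
    finally show "real_of_int \<bar>g p\<bar> \<le> (case p of (i, j) \<Rightarrow> s * norm (ys ! i - (0 # ys) ! i) + 1)"
      by (simp add: ij)
  qed
  also have "\<dots> = CARD('d) * (s * path_length (0 # ys) + n)"
    unfolding I_def
    by (simp add: sum.cartesian_product[symmetric] path_length_def n_def sum.distrib sum_distrib_left
        algebra_simps)
  also have "\<dots> \<le> real CARD('d) * (real n + real n)"
    using short by (intro mult_left_mono) (auto simp: n_def)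
  also have "\<dots> = real_of_int (2 * int (card I))"
    by (simp add: I_def card_cartesian_product algebra_simps)
  finally have "g \<in> short_steps I"
    unfolding short_steps_def by (auto simp only: of_int_le_iff mem_Collect_eq) (auto simp: g_def)
  moreover have "\<omega> \<in> occupied s t n (site g)"
    unfolding occupied_def mem_Collect_eq
  proof (intro conjI ballI \<omega>)
    fix c
    obtain r where r: "\<And>y. y \<in> set ys \<Longrightarrow> r y \<ge> t \<and> (y, r y) \<in> \<xi> \<omega>"
      using ys(3) by metis
    show "card {i. i < n \<and> site g i = c} \<le> N (bin s t c) \<omega>"
    proof (rule card_inj_on_le[OF _ _ fin])
      show "inj_on (\<lambda>i. (ys ! i, r (ys ! i))) {i. i < n \<and> site g i = c}"
        using ys(1) by (auto simp: inj_on_def n_def nth_eq_iff_index_eq)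
      show "(\<lambda>i. (ys ! i, r (ys ! i))) ` {i. i < n \<and> site g i = c} \<subseteq> \<xi> \<omega> \<inter> bin s t c"
        using r site by (auto simp: n_def bin_def cell_def f_def fun_eq_iff)
    qed
  qed
  moreover obtain n' where "n = Suc n'" using ys(2) by (cases n) (auto simp: n_def)
  ultimately show ?thesis by (auto simp: crowded_def I_def)
qed

lemma level_S_bound:
  assumes dim: "CARD('d) \<ge> 2" and s0: "s0 > 0"
    and le: "2 * 12 ^ CARD('d) * measure \<nu> {t..} \<le> s0 ^ CARD('d)"
  obtains Y where "Y \<in> borel_measurable M" "AE \<omega> in M. level_S (\<xi> \<omega>) t \<le> Y \<omega>"
    "(\<integral>\<^sup>+ \<omega>. Y \<omega> \<partial>M) \<le> ennreal (5 * s0)"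
proof
  define s where "s l = s0 * 2 ^ l" for l :: nat
  define Y where "Y \<omega> = ennreal s0 + (\<Sum>l. ennreal (s (Suc l)) * indicator (crowded (s l) t) \<omega>)" for \<omega>
  have s: "s l > 0" for l using s0 by (simp add: s_def)
  have [measurable]: "crowded (s l) t \<in> events" for l by (rule crowded_events[OF s])
  show [measurable]: "Y \<in> borel_measurable M" unfolding Y_def by measurable
  have "AE \<omega> in M. \<forall>l z. finite (\<xi> \<omega> \<inter> bin (s l) t z)"
    unfolding AE_all_countable
    by (intro allI AE_finite_points bin_sets emeasure_bin_finite s)
  then show "AE \<omega> in M. level_S (\<xi> \<omega>) t \<le> Y \<omega>"
    using AE_space
  proof eventually_elim
    case (elim \<omega>)
    show ?case unfolding level_S_def
    proof (rule SUP_least, clarsimp)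
      fix \<pi> :: "(real^'d) list"
      assume \<pi>: "\<pi> \<noteq> []" "distinct \<pi>" "hd \<pi> = 0" "path_length \<pi> > 0"
      define ys where "ys = filter (\<lambda>x. \<exists>r\<ge>t. (x, r) \<in> \<xi> \<omega>) \<pi>"
      define a where "a = real (length ys) / path_length \<pi>"
      show "ennreal (real (length ys) / path_length \<pi>) \<le> Y \<omega>"
        unfolding a_def[symmetric]
      proof (cases "a \<le> s0")
        case True
        then show "ennreal a \<le> Y \<omega>" by (simp add: Y_def add_increasing2 ennreal_leI)
      next
        case False
        have "\<exists>m. a \<le> s m"
        proof -
          obtain m where "a / s0 < 2 ^ m" using real_arch_pow[of 2 "a / s0"] by auto
          then show ?thesis using s0 by (intro exI[of _ m]) (simp add: s_def field_simps)
        qed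
        moreover have "\<not> a \<le> s 0" using False by (simp add: s_def)
        ultimately obtain l where l: "\<not> a \<le> s l" "a \<le> s (Suc l)"
          using ex_least_nat_less[of "\<lambda>m. a \<le> s m"] by blast
        have "\<omega> \<in> crowded (s l) t"
        proof (rule crowdedI[OF s, where ys = ys])
          show "ys \<noteq> []" using l(1) s[of l] by (auto simp: a_def)
          have "s l * path_length (0 # ys) \<le> s l * path_length \<pi>"
            using s[of l] \<pi> path_length_filter_from_hd[of \<pi> 0] unfolding ys_def
            by (intro mult_left_mono) auto
          also have "\<dots> \<le> length ys" using l(1) \<pi>(4) by (simp add: a_def field_simps)
          finally show "s l * path_length (0 # ys) \<le> length ys" .
        qed (use elim \<pi> in \<open>auto simp: ys_def\<close>)
        then have "ennreal a \<le> ennreal (s (Suc l)) * indicator (crowded (s l) t) \<omega>"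
          using l by (simp add: ennreal_leI)
        also have "\<dots> \<le> (\<Sum>l. ennreal (s (Suc l)) * indicator (crowded (s l) t) \<omega>)"
          using sum_le_suminf[of "\<lambda>l. ennreal (s (Suc l)) * indicator (crowded (s l) t) \<omega>" "{l}"]
          by (simp only: summableI sum.insert sum.empty finite.emptyI finite.insertI empty_iff
              not_False_eq_True add_0_right zero_le simp_thms)
        also have "\<dots> \<le> Y \<omega>" by (simp add: Y_def)
        finally show "ennreal a \<le> Y \<omega>" .
      qed
    qed
  qed
  have crowded: "emeasure M (crowded (s l) t) \<le> ennreal ((1/4) ^ l)" for l
  proof -
    have "12 ^ CARD('d) * (measure \<nu> {t..} * (1 / s l) ^ CARD('d))
        = 2 * 12 ^ CARD('d) * measure \<nu> {t..} * (1 / s l) ^ CARD('d) / 2"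
      by simp
    also have "\<dots> \<le> s0 ^ CARD('d) * (1 / s l) ^ CARD('d) / 2"
      using le s[of l] by (intro divide_right_mono mult_right_mono) auto
    also have "\<dots> = (1 / 2 ^ l) ^ CARD('d) / 2"
      using s0 by (simp add: s_def flip: power_mult_distrib)
    also have "\<dots> \<le> (1 / 2 ^ l) ^ 2 / 2"
      using dim by (intro divide_right_mono power_decreasing) (auto simp: divide_le_eq)
    also have "(1 / 2 ^ l) ^ 2 = (1/4 :: real) ^ l"
      by (simp add: power_one_over power2_eq_square flip: power_mult_distrib)
    finally have "emeasure M (crowded (s l) t) \<le> ennreal (2 * ((1/4) ^ l / 2))"
      by (intro emeasure_crowded_le s) (auto simp: power_le_one)
    then show ?thesis by simp
  qed
  have "(\<integral>\<^sup>+ \<omega>. Y \<omega> \<partial>M) = ennreal s0 + (\<Sum>l. ennreal (s (Suc l)) * emeasure M (crowded (s l) t))"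
    unfolding Y_def
    by (simp add: nn_integral_add nn_integral_suminf nn_integral_cmult_indicator emeasure_space_1)
  also have "(\<Sum>l. ennreal (s (Suc l)) * emeasure M (crowded (s l) t)) \<le> (\<Sum>l. ennreal (2 * s0 * (1/2) ^ l))"
  proof (intro suminf_le summableI)
    fix l
    have "ennreal (s (Suc l)) * emeasure M (crowded (s l) t) \<le> ennreal (s (Suc l)) * ennreal ((1/4) ^ l)"
      by (intro mult_left_mono crowded) auto
    also have "\<dots> = ennreal (s (Suc l) * (1/4) ^ l)"
      using s[of "Suc l"] by (simp add: ennreal_mult)
    also have "s (Suc l) * (1/4) ^ l = 2 * s0 * (1/2) ^ l"
      by (simp add: s_def flip: power_mult_distrib)
    finally show "ennreal (s (Suc l)) * emeasure M (crowded (s l) t) \<le> ennreal (2 * s0 * (1/2) ^ l)" .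
  qed
  also have "(\<Sum>l. ennreal (2 * s0 * (1/2) ^ l)) = ennreal (\<Sum>l. 2 * s0 * (1/2) ^ l)"
    using s0 by (intro suminf_ennreal2) (auto intro!: summable_mult summable_geometric)
  also have "(\<Sum>l. 2 * s0 * (1/2) ^ l) = 4 * s0"
    by (simp add: suminf_mult suminf_geometric summable_geometric)
  also have "ennreal s0 + ennreal (4 * s0) = ennreal (5 * s0)"
    using s0 by (simp flip: ennreal_plus)
  finally show "(\<integral>\<^sup>+ \<omega>. Y \<omega> \<partial>M) \<le> ennreal (5 * s0)"
    by simp
qed

lemma greedy_S_integrable_bound:
  assumes dim: "CARD('d) \<ge> 2"
    and int: "(\<integral>\<^sup>+ r\<in>{0<..}. ennreal (measure \<nu> {r..} powr (1 / real CARD('d))) \<partial>lborel) < \<infinity>"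
  shows "\<exists>Y \<in> borel_measurable M. (\<forall>\<omega>\<in>space M. greedy_S (\<xi> \<omega>) \<le> Y \<omega>) \<and> (\<integral>\<^sup>+ \<omega>. Y \<omega> \<partial>M) < \<infinity>"
proof -
  define d where "d = CARD('d)"
  define f where "f r = measure \<nu> {r..} powr (1 / real d)" for r
  define C where "C = (2 * 12 ^ d :: real)"
  \<comment> \<open>The summand \<open>(1/2) ^ j\<close> keeps \<open>s0 j\<close> positive when \<open>\<nu> [j, \<infinity>) = 0\<close>.\<close>
  define s0 where "s0 j = (C * measure \<nu> {real j..}) powr (1 / real d) + (1/2) ^ j" for j
  have d: "d > 0" "C > 0" using dim by (auto simp: d_def C_def)
  have s0: "s0 j > 0" for j by (simp add: s0_def add_nonneg_pos)
  have pow: "(x powr (1 / real d)) ^ d = x" if "x \<ge> 0" for x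
    using that d by (cases "x = 0") (auto simp: powr_powr simp flip: powr_realpow)
  have "\<exists>Y. Y \<in> borel_measurable M \<and> (AE \<omega> in M. level_S (\<xi> \<omega>) (real j) \<le> Y \<omega>) \<and>
      (\<integral>\<^sup>+ \<omega>. Y \<omega> \<partial>M) \<le> ennreal (5 * s0 j)" for j
  proof -
    have "C * measure \<nu> {real j..} = ((C * measure \<nu> {real j..}) powr (1 / real d)) ^ d"
      using d by (subst pow) auto
    also have "\<dots> \<le> s0 j ^ d" by (intro power_mono) (auto simp: s0_def)
    finally show ?thesis
      using level_S_bound[OF dim s0[of j], of "real j"] unfolding C_def d_def by metis
  qed
  then obtain Y where Y: "\<And>j. Y j \<in> borel_measurable M"
    "\<And>j. AE \<omega> in M. level_S (\<xi> \<omega>) (real j) \<le> Y j \<omega>"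
    "\<And>j. (\<integral>\<^sup>+ \<omega>. Y j \<omega> \<partial>M) \<le> ennreal (5 * s0 j)"
    by metis
  note [measurable] = Y(1)
  have "AE \<omega> in M. \<forall>j. level_S (\<xi> \<omega>) (real j) \<le> Y j \<omega>"
    using Y(2) by (simp add: AE_all_countable)
  then have "AE \<omega> in M. greedy_S (\<xi> \<omega>) \<le> (\<Sum>j. Y j \<omega>)"
  proof eventually_elim
    case (elim \<omega>)
    then have "(\<Sum>j. level_S (\<xi> \<omega>) (real j)) \<le> (\<Sum>j. Y j \<omega>)" by (intro suminf_le summableI) auto
    then show ?case using greedy_S_le_suminf_level_S order_trans by blast
  qed
  then obtain Z where Z: "{\<omega>\<in>space M. \<not> greedy_S (\<xi> \<omega>) \<le> (\<Sum>j. Y j \<omega>)} \<subseteq> Z"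
    "emeasure M Z = 0" "Z \<in> events" by (rule AE_E)
  note [measurable] = Z(3)
  define Y' where "Y' \<omega> = (if \<omega> \<in> Z then \<infinity> else (\<Sum>j. Y j \<omega>))" for \<omega>
  have "(\<integral>\<^sup>+ \<omega>. Y' \<omega> \<partial>M) = (\<integral>\<^sup>+ \<omega>. (\<Sum>j. Y j \<omega>) \<partial>M)"
    using AE_not_in[of Z M] Z by (intro nn_integral_cong_AE) (auto simp: Y'_def null_sets_def)
  also have "\<dots> = (\<Sum>j. \<integral>\<^sup>+ \<omega>. Y j \<omega> \<partial>M)" by (intro nn_integral_suminf) auto
  also have "\<dots> \<le> (\<Sum>j. ennreal (5 * s0 j))" using Y(3) by (intro suminf_le summableI)
  also have "\<dots> = (\<Sum>j. ennreal (5 * C powr (1 / real d)) * ennreal (f (real j)) + ennreal (5 * (1/2) ^ j))"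
  proof (intro suminf_cong)
    fix j
    have "5 * s0 j = 5 * C powr (1 / real d) * f (real j) + 5 * (1/2) ^ j"
      using d by (simp add: s0_def f_def powr_mult algebra_simps)
    then show "ennreal (5 * s0 j) = ennreal (5 * C powr (1 / real d)) * ennreal (f (real j)) + ennreal (5 * (1/2) ^ j)"
      by (simp add: ennreal_mult f_def)
  qed
  also have "\<dots> = ennreal (5 * C powr (1 / real d)) * (\<Sum>j. ennreal (f (real j))) + (\<Sum>j. ennreal (5 * (1/2) ^ j))"
    by (simp add: suminf_add[symmetric] summableI)
  also have "\<dots> < \<infinity>"
  proof -
    have "antimono f"
      unfolding f_def
      by (intro antimonoI powr_mono2 nu.finite_measure_mono) (auto simp: nu_sets)
    then have "antimono (\<lambda>r. ennreal (f r))"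
      by (auto simp: antimono_def ennreal_leI)
    from suminf_nat_le_nn_integral[OF this] int
    have fin: "(\<Sum>j. ennreal (f (real (Suc j)))) < \<infinity>"
      unfolding f_def d_def by (rule le_less_trans)
    have "(\<lambda>j. ennreal (f (real j))) sums ((\<Sum>j. ennreal (f (real (Suc j)))) + ennreal (f (real 0)))"
      by (intro sums_Suc summable_sums summableI)
    then have "(\<Sum>j. ennreal (f (real j))) = (\<Sum>j. ennreal (f (real (Suc j)))) + ennreal (f (real 0))"
      by (rule sums_unique[symmetric])
    then have "(\<Sum>j. ennreal (f (real j))) < \<infinity>"
      using fin by simp
    moreover have "(\<Sum>j. ennreal (5 * (1/2) ^ j)) = ennreal (\<Sum>j. 5 * (1/2) ^ j)"
      by (intro suminf_ennreal2) (auto intro!: summable_mult summable_geometric)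
    ultimately show ?thesis by (simp add: ennreal_mult_less_top)
  qed
  finally have "(\<integral>\<^sup>+ \<omega>. Y' \<omega> \<partial>M) < \<infinity>" .
  moreover have "Y' \<in> borel_measurable M" unfolding Y'_def by measurable
  moreover have "\<forall>\<omega>\<in>space M. greedy_S (\<xi> \<omega>) \<le> Y' \<omega>"
    using Z(1) by (auto simp: Y'_def)
  ultimately show ?thesis by blast
qed

lemma AE_marks_pos:
  assumes "emeasure \<nu> {..0} = 0"
  shows "AE \<omega> in M. \<forall>(x, r)\<in>\<xi> \<omega>. r > 0"
proof -
  have "emeasure \<mu> (UNIV \<times> {..0}) = emeasure lborel (UNIV :: (real^'d) set) * emeasure \<nu> {..0}"
    by (intro nu.emeasure_pair_measure_Times) (auto simp: nu_sets)
  then have "AE \<omega> in M. \<xi> \<omega> \<inter> (UNIV \<times> {..0}) = {}"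
    using assms by (intro AE_no_points pair_measureI) (auto simp: nu_sets)
  then show ?thesis by eventually_elim (auto simp: not_le[symmetric])
qed

text \<open>Two marks at the same \<open>x\<close> put two points above the cell of \<open>x\<close> at every mesh \<open>1/m\<close>; a fixed
  window has \<open>O(m\<^sup>d)\<close> cells, each containing two points with probability \<open>O(1/m\<^sup>2\<^sup>d)\<close>.\<close>
lemma AE_unique_marks:
  "AE \<omega> in M. \<forall>x r r'. (x, r) \<in> \<xi> \<omega> \<longrightarrow> (x, r') \<in> \<xi> \<omega> \<longrightarrow> r \<ge> 0 \<longrightarrow> r' \<ge> 0 \<longrightarrow> r = r'"
proof -
  define Z where "Z R m = ((UNIV :: 'd set) \<rightarrow>\<^sub>E {- int (R * Suc m)..int (R * Suc m)})" for R m
  define D where "D R m = (\<Union>z\<in>Z R m. {\<omega>\<in>space M. 2 \<le> N (bin (real (Suc m)) 0 z) \<omega>})" for R m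
  have [measurable]: "N (bin (real (Suc m)) 0 z) \<in> M \<rightarrow>\<^sub>M count_space UNIV" for m z
    by (intro measurable_N bin_sets emeasure_bin_finite) simp
  have finZ: "finite (Z R m)" for R m unfolding Z_def by (intro finite_PiE) auto
  have Nev: "{\<omega>\<in>space M. 2 \<le> N (bin (real (Suc m)) 0 z) \<omega>} \<in> events" for m z
    by measurable
  have Dev: "D R m \<in> events" for R m
    unfolding D_def using finZ Nev by (intro sets.finite_UN)
  have D: "prob (D R m) \<le> (real (2 * R + 1) ^ CARD('d) * (measure \<nu> {0..})\<^sup>2) * inverse (real (Suc m))"
    for R m
  proof -
    define h where "h = 1 / real (Suc m)"
    have h: "0 < h" "h \<le> 1" by (auto simp: h_def)
    have "prob (D R m) \<le> (\<Sum>z\<in>Z R m. prob {\<omega>\<in>space M. 2 \<le> N (bin (real (Suc m)) 0 z) \<omega>})"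
      unfolding D_def using finZ Nev by (intro finite_measure_subadditive_finite) auto
    also have "\<dots> \<le> (\<Sum>z\<in>Z R m. (measure \<nu> {0..} * h ^ CARD('d))\<^sup>2)"
    proof (intro sum_mono)
      fix z
      have "prob {\<omega>\<in>space M. 2 \<le> N (bin (real (Suc m)) 0 z) \<omega>} \<le> (measure \<mu> (bin (real (Suc m)) 0 z))\<^sup>2"
        by (intro prob_N_ge_le bin_sets emeasure_bin_finite) simp
      also have "\<dots> \<le> (measure \<nu> {0..} * h ^ CARD('d))\<^sup>2"
        unfolding h_def by (intro power_mono measure_bin_le) auto
      finally show "prob {\<omega>\<in>space M. 2 \<le> N (bin (real (Suc m)) 0 z) \<omega>} \<le> (measure \<nu> {0..} * h ^ CARD('d))\<^sup>2" .
    qed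
    also have "\<dots> = real (card (Z R m)) * (measure \<nu> {0..} * h ^ CARD('d))\<^sup>2"
      by simp
    also have "card (Z R m) = (2 * R * Suc m + 1) ^ CARD('d)"
      unfolding Z_def by (simp add: card_PiE nat_add_distrib nat_mult_distrib algebra_simps)
    also have "real \<dots> * (measure \<nu> {0..} * h ^ CARD('d))\<^sup>2
        \<le> (real (2 * R + 1) * real (Suc m)) ^ CARD('d) * (measure \<nu> {0..} * h ^ CARD('d))\<^sup>2"
      unfolding of_nat_power of_nat_mult[symmetric]
      by (intro mult_right_mono power_mono) auto
    also have "(real (2 * R + 1) * real (Suc m)) ^ CARD('d) * (measure \<nu> {0..} * h ^ CARD('d))\<^sup>2
        = (real (2 * R + 1) ^ CARD('d) * (measure \<nu> {0..})\<^sup>2) * ((real (Suc m) * h) ^ CARD('d) * h ^ CARD('d))"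
      by (simp only: power_mult_distrib power2_eq_square mult_ac)
    also have "real (Suc m) * h = 1" by (simp add: h_def)
    also have "(real (2 * R + 1) ^ CARD('d) * (measure \<nu> {0..})\<^sup>2) * (1 ^ CARD('d) * h ^ CARD('d))
        \<le> (real (2 * R + 1) ^ CARD('d) * (measure \<nu> {0..})\<^sup>2) * h"
      using h power_decreasing[of 1 "CARD('d)" h] by (intro mult_left_mono) (auto simp: Suc_leI)
    finally show ?thesis
      by (simp only: h_def inverse_eq_divide)
  qed
  have "AE \<omega> in M. \<omega> \<notin> (\<Inter>m. D R m)" for R
  proof (rule AE_not_in)
    have ev: "(\<Inter>m. D R m) \<in> events" using Dev by auto
    have "prob (\<Inter>m. D R m) \<le> (real (2 * R + 1) ^ CARD('d) * (measure \<nu> {0..})\<^sup>2) * inverse (real (Suc m))" for m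
      using D[of R m] finite_measure_mono[OF _ Dev, of "\<Inter>m. D R m" R m] by fastforce
    moreover have "(\<lambda>m. (real (2 * R + 1) ^ CARD('d) * (measure \<nu> {0..})\<^sup>2) * inverse (real (Suc m)))
        \<longlonglongrightarrow> (real (2 * R + 1) ^ CARD('d) * (measure \<nu> {0..})\<^sup>2) * 0"
      by (intro tendsto_mult tendsto_const LIMSEQ_inverse_real_of_nat)
    ultimately have "prob (\<Inter>m. D R m) \<le> 0"
      by (intro LIMSEQ_le_const) auto
    then show "(\<Inter>m. D R m) \<in> null_sets M"
      using ev by (auto simp: null_sets_def emeasure_eq_measure measure_le_0_iff)
  qed
  then have "AE \<omega> in M. \<forall>R. \<omega> \<notin> (\<Inter>m. D R m)"
    by (simp add: AE_all_countable)
  moreover have "AE \<omega> in M. \<forall>m z. finite (\<xi> \<omega> \<inter> bin (real (Suc m)) 0 z)"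
    unfolding AE_all_countable
    by (intro allI AE_finite_points bin_sets emeasure_bin_finite) simp
  ultimately show ?thesis
    using AE_space
  proof eventually_elim
    case (elim \<omega>)
    show ?case
    proof (intro allI impI, rule ccontr)
      fix x r r'
      assume x: "(x, r) \<in> \<xi> \<omega>" "(x, r') \<in> \<xi> \<omega>" "r \<ge> 0" "r' \<ge> 0" "r \<noteq> r'"
      obtain R where R: "norm x \<le> real R" using real_arch_simple by blast
      have "\<omega> \<in> D R m" for m
      proof -
        define z where "z j = \<lfloor>real (Suc m) * x $ j\<rfloor>" for j
        have "z \<in> Z R m"
        proof -
          have "\<bar>real (Suc m) * x $ j\<bar> \<le> real (R * Suc m)" for j
            unfolding abs_mult abs_of_nat of_nat_mult mult.commute[of "real (Suc m)"]
            by (intro mult_right_mono order_trans[OF component_le_norm_cart R]) simp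
          then have "z j \<in> {- int (R * Suc m)..int (R * Suc m)}" for j
            unfolding z_def atLeastAtMost_iff le_floor_iff floor_le_iff abs_le_iff
            by (smt (verit) of_int_minus of_int_of_nat_eq)
          then show ?thesis unfolding Z_def by (intro PiE_I) auto
        qed
        moreover have "card {(x, r), (x, r')} \<le> N (bin (real (Suc m)) 0 z) \<omega>"
          using elim(2) x by (intro card_mono) (auto simp: bin_def cell_def z_def)
        then have "2 \<le> N (bin (real (Suc m)) 0 z) \<omega>" using x(5) by simp
        ultimately show ?thesis using elim(3) by (auto simp: D_def)
      qed
      then show False using elim(1) by blast
    qed
  qed
qed

lemma AE_point_in_cone:
  assumes supp: "emeasure \<nu> {..0} = 0"
    and inf: "(\<integral>\<^sup>+ r. ennreal (r ^ CARD('d)) \<partial>\<nu>) = \<infinity>"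
    and K: "K > 0"
  shows "AE \<omega> in M. \<exists>x r. (x, r) \<in> \<xi> \<omega> \<and> (\<forall>j. 0 < x $ j \<and> K * x $ j < r)"
proof -
  interpret P: pair_sigma_finite "lborel :: (real^'d) measure" \<nu>
    by standard
  define B where "B n = {p :: (real^'d) \<times> real. (\<forall>j. 0 < fst p $ j \<and> K * fst p $ j < snd p) \<and> snd p \<le> real n}"
    for n :: nat
  define f where "f n r = ennreal ((1 / K) ^ CARD('d)) * (ennreal (r ^ CARD('d)) * indicator {0<..real n} r)"
    for n :: nat and r
  have B: "B n \<in> sets \<mu>" for n
  proof -
    have [measurable]: "(\<lambda>p. fst p $ j) \<in> borel_measurable \<mu>" for j
      by (rule measurable_compose[OF measurable_fst]) simp
    have [measurable]: "snd \<in> borel_measurable \<mu>"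
      using measurable_snd[of lborel \<nu>] by (simp cong: measurable_cong_sets add: nu_sets)
    have "{p \<in> space \<mu>. (\<forall>j. 0 < fst p $ j \<and> K * fst p $ j < snd p) \<and> snd p \<le> real n} \<in> sets \<mu>"
      by measurable
    then show ?thesis by (simp add: B_def space_pair_measure sets_eq_imp_space_eq[OF nu_sets])
  qed
  have slice: "emeasure lborel ((\<lambda>x. (x, r)) -` B n) = f n r" for n r
  proof (cases "0 < r \<and> r \<le> real n")
    case True
    define b where "b = (\<chi> j::'d. r / K)"
    have "(\<lambda>x. (x, r)) -` B n = box 0 b"
      using True K by (auto simp: B_def b_def mem_box_cart field_simps)
    moreover have "emeasure lborel (box 0 b) = ennreal (measure lborel (box 0 b))"
      by (metis emeasure_eq_ennreal_measure emeasure_lborel_box_finite less_irrefl infinity_ennreal_def)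
    moreover have "measure lborel (box 0 b) = (\<Prod>i\<in>UNIV. b $ i - 0 $ i)"
      using True K unfolding measure_lborel_box_eq
      by (subst content_cbox_cart[symmetric]) (auto simp: interval_ne_empty_cart b_def measure_lborel_cbox_eq)
    ultimately show ?thesis
      using True K by (simp add: f_def b_def power_divide ennreal_mult[symmetric])
  next
    case False
    have "(\<lambda>x. (x, r)) -` B n = {}"
    proof -
      have "r > 0" if "\<forall>j. 0 < x $ j \<and> K * x $ j < r" for x :: "real^'d"
        using that K by (meson less_trans mult_pos_pos)
      then show ?thesis using False by (auto simp: B_def)
    qed
    then show ?thesis using False by (auto simp: f_def indicator_def)
  qed
  have f_meas [measurable]: "f n \<in> borel_measurable \<nu>" for n unfolding f_def by measurable
  have emB: "emeasure \<mu> (B n) = (\<integral>\<^sup>+ r. f n r \<partial>\<nu>)" for n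
    by (simp only: P.emeasure_pair_measure_alt2[OF B] slice)
  have fin: "emeasure \<mu> (B n) < \<infinity>" for n
  proof -
    have "emeasure \<mu> (B n) \<le> (\<integral>\<^sup>+ r. ennreal ((1 / K) ^ CARD('d)) * ennreal (real n ^ CARD('d)) \<partial>\<nu>)"
      unfolding emB f_def
      by (intro nn_integral_mono mult_left_mono) (auto simp: indicator_def intro!: ennreal_leI power_mono)
    also have "\<dots> < \<infinity>"
      by (auto simp: less_top[symmetric] ennreal_mult_eq_top_iff)
    finally show ?thesis .
  qed
  have "(SUP n. emeasure \<mu> (B n)) = (\<integral>\<^sup>+ r. (SUP n. f n r) \<partial>\<nu>)"
    unfolding emB
  proof (rule nn_integral_monotone_convergence_SUP[symmetric])
    show "incseq f"
      by (auto simp: incseq_def le_fun_def f_def indicator_def intro!: mult_left_mono)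
  qed simp
  also have "\<dots> = (\<integral>\<^sup>+ r. ennreal ((1 / K) ^ CARD('d)) * ennreal (r ^ CARD('d)) \<partial>\<nu>)"
  proof (rule nn_integral_cong_AE)
    have "AE r in \<nu>. r \<notin> {..0}"
      using supp by (intro AE_not_in) (auto simp: null_sets_def nu_sets)
    then show "AE r in \<nu>. (SUP n. f n r) = ennreal ((1 / K) ^ CARD('d)) * ennreal (r ^ CARD('d))"
    proof eventually_elim
      case (elim r)
      obtain n where n: "r \<le> real n" using real_arch_simple by blast
      show ?case
      proof (rule antisym)
        show "(SUP n. f n r) \<le> ennreal ((1 / K) ^ CARD('d)) * ennreal (r ^ CARD('d))"
          by (intro SUP_least) (auto simp: f_def indicator_def)
        show "ennreal ((1 / K) ^ CARD('d)) * ennreal (r ^ CARD('d)) \<le> (SUP n. f n r)"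
          using elim n by (intro SUP_upper2[of n]) (auto simp: f_def)
      qed
    qed
  qed
  also have "\<dots> = ennreal ((1 / K) ^ CARD('d)) * \<infinity>"
    by (subst nn_integral_cmult) (auto simp: inf)
  also have "\<dots> = \<infinity>" using K by (simp add: ennreal_mult_eq_top_iff)
  finally have SUP: "(SUP n. emeasure \<mu> (B n)) = \<infinity>" .
  have [measurable]: "N (B n) \<in> M \<rightarrow>\<^sub>M count_space UNIV" for n
    by (rule measurable_N[OF B fin])
  define A where "A = {\<omega>\<in>space M. \<forall>n. N (B n) \<omega> = 0}"
  have A: "A \<in> events" unfolding A_def by measurable
  have "prob A \<le> \<epsilon>" if "\<epsilon> > 0" for \<epsilon>
  proof -
    obtain n where n: "emeasure \<mu> (B n) > ennreal (- ln \<epsilon>)"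
    proof -
      have "ennreal (- ln \<epsilon>) < (SUP n. emeasure \<mu> (B n))" unfolding SUP by simp
      then show ?thesis using that unfolding less_SUP_iff by blast
    qed
    have "emeasure \<mu> (B n) = ennreal (measure \<mu> (B n))"
      using fin[of n] by (intro emeasure_eq_ennreal_measure) auto
    with n have "- ln \<epsilon> \<le> measure \<mu> (B n)"
      using ennreal_leI[of "measure \<mu> (B n)" "- ln \<epsilon>"] by (auto simp flip: not_less)
    then have "exp (- measure \<mu> (B n)) \<le> \<epsilon>"
      using that by (metis exp_ln exp_le_cancel_iff minus_le_iff)
    moreover have "prob A \<le> prob {\<omega>\<in>space M. N (B n) \<omega> = 0}"
      unfolding A_def by (intro finite_measure_mono) auto
    ultimately show ?thesis using prob_N_eq[OF B fin, of n 0] by simp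
  qed
  then have "prob A \<le> 0" by (rule field_le_epsilon[of "prob A" 0, simplified])
  then have "AE \<omega> in M. \<omega> \<notin> A"
    using A by (intro AE_not_in) (auto simp: null_sets_def emeasure_eq_measure measure_le_0_iff)
  then show ?thesis
    using AE_space
  proof eventually_elim
    case (elim \<omega>)
    then obtain n where "N (B n) \<omega> \<noteq> 0" by (auto simp: A_def)
    then have "\<xi> \<omega> \<inter> B n \<noteq> {}" by force
    then show ?case by (force simp: B_def)
  qed
qed

lemma AE_greedy_S_infinite:
  assumes supp: "emeasure \<nu> {..0} = 0"
    and inf: "(\<integral>\<^sup>+ r. ennreal (r ^ CARD('d)) \<partial>\<nu>) = \<infinity>"
  shows "AE \<omega> in M. greedy_S (\<xi> \<omega>) = \<infinity>"
proof -
  have "AE \<omega> in M. \<forall>k. \<exists>x r. (x, r) \<in> \<xi> \<omega> \<and> (\<forall>j. 0 < x $ j \<and> real (Suc k) * x $ j < r)"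
    unfolding AE_all_countable by (intro allI AE_point_in_cone assms) simp
  then show ?thesis
    using AE_marks_pos[OF supp] AE_unique_marks
  proof eventually_elim
    case (elim \<omega>)
    have *: "greedy_S (\<xi> \<omega>) \<ge> ennreal (real (Suc k) / CARD('d))" for k
      using elim(1)[rule_format, of k] greedy_S_ge_of_point[OF elim(2,3)] by (metis of_nat_0_less_iff zero_less_Suc)
    have "ennreal a \<le> greedy_S (\<xi> \<omega>)" for a
    proof -
      obtain k where "a * CARD('d) \<le> real k" using real_arch_simple by blast
      then have "a \<le> real (Suc k) / CARD('d)" by (simp add: field_simps)
      then show ?thesis using *[of k] ennreal_leI order_trans by blast
    qed
    note ge = this
    show ?case
    proof (cases "greedy_S (\<xi> \<omega>)")
      case (real a)
      then have "ennreal (a + 1) \<le> ennreal a" using ge[of "a + 1"] by simp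
      then show ?thesis using real by (simp add: ennreal_le_iff)
    qed simp
  qed
qed

end

theorem theorem1p2:
  fixes M :: "'w measure"
    and \<nu> :: "real measure"
    and \<xi> :: "'w \<Rightarrow> ((real^'d) \<times> real) set"
  assumes dim: "CARD('d) \<ge> 2"
    and nu_sets: "sets \<nu> = sets borel"
    and nu_finite: "finite_measure \<nu>"
    and nu_support: "emeasure \<nu> {..0} = 0"
    and ppp: "poisson_point_process M (lborel \<Otimes>\<^sub>M \<nu>) \<xi>"
  shows "((\<integral>\<^sup>+ r\<in>{0<..}. ennreal (measure \<nu> {r..} powr (1 / real CARD('d))) \<partial>lborel) < \<infinity>
            \<longrightarrow> (\<exists>Y \<in> borel_measurable M. (\<forall>\<omega>\<in>space M. greedy_S (\<xi> \<omega>) \<le> Y \<omega>)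
                  \<and> (\<integral>\<^sup>+ \<omega>. Y \<omega> \<partial>M) < \<infinity>))
         \<and> ((\<integral>\<^sup>+ r. ennreal (r ^ CARD('d)) \<partial>\<nu>) = \<infinity>
            \<longrightarrow> (AE \<omega> in M. greedy_S (\<xi> \<omega>) = \<infinity>))"
proof -
  interpret marked_poisson_process M \<nu> \<xi>
    using nu_sets nu_finite ppp by (rule marked_poisson_process.intro)
  show ?thesis
    using greedy_S_integrable_bound[OF dim] AE_greedy_S_infinite[OF nu_support] by blast
qed

end
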